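(* Let $f(t),g(t)\in\mathbb{R}[[t]]$ with $f(0)=0$ and $f'(0)g(0)\ne 0$. Let $r_1,r_2$ be positive integers, let $g(t)$ be a PF$_{r_1}$ function, and suppose that at least one of $f(t)$ and $1/\bar f'(t)$ is a PF$_{r_2}$ function. Let $r=\min\{r_1,r_2\}$. Then: (i) both $[S_{n,k}(f,g)]_{n,k\ge 0}$ and $[S_{n,k}(f,g(f))]_{n,k\ge 0}$ are TP$_r$; (ii) both $[A_{n,k}(f,g)]_{n,k\ge 0}$ and $[A_{n,k}(f,g(f))]_{n,k\ge 0}$ are TP$_r$; (iii) $[L_{n,k}(f)]_{n,k\ge 0}$ is TP$_r$; (iv) $[\widetilde L_{n,k}(f)]_{n,k\ge 0}$ is TP$_r$.
   Context: A real matrix is TP$_r$ if all its minors of order $k\le r$ are nonnegative. A formal power series $\sum_{n\ge 0}a_nt^n\in\mathbb{R}[[t]]$ is a PF$_r$ function if its Toeplitz matrix $[a_{i-j}]_{i,j\ge 0}$ (with $a_m=0$ for $m<0$) is TP$_r$. $\bar f$ denotes the compositional inverse of $f$ and $\bar f'$ its derivative. $g(f)$ denotes the series $g(f(t))$. For power series $f,g$ with $f(0)=0$, $f'(0)g(0)\neq 0$, the cycle-index-triangle $[A_{n,k}(f,g)]$ and the Sheffer-triangle $[S_{n,k}(f,g)]$ are defined by $$g(t)\exp(qf(t))=\sum_{n\ge 0}\Big(\sum_{k=0}^nA_{n,k}(f,g)q^k\Big)t^n=\sum_{n\ge 0}\Big(\sum_{k=0}^nS_{n,k}(f,g)q^k\Big)\frac{t^n}{n!}.$$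 The logarithmic triangle $[L_{n,k}(f)]$ and the fractional triangle $[\widetilde L_{n,k}(f)]$ are defined by $$\log(1-qf(t))=-\sum_{n\ge 1}\Big(\sum_{k=1}^nL_{n,k}(f)q^k\Big)\frac{t^n}{n!},\qquad \frac{1}{1-qf(t)}=1+\sum_{n\ge 1}\Big(\sum_{k=1}^n\widetilde L_{n,k}(f)q^k\Big)\frac{t^n}{n!},$$ with $L_{0,0}(f)=\widetilde L_{0,0}(f)=1$. All these arrays have entries $0$ at positions not specified above (i.e. they are lower triangular, and $L_{n,0}=\widetilde L_{n,0}=0$ for $n\ge 1$). *)

theory Defs
  imports
    "HOL-Computational_Algebra.Formal_Power_Series"
    "HOL-Computational_Algebra.Polynomial"
    "Jordan_Normal_Form.Determinant"
begin

unbundle fps_syntax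
no_notation vec_index (infixl "$" 100)

section \<open>Total positivity of infinite matrices\<close>

text \<open>
  Infinite real matrices indexed by pairs of natural numbers are functions
  \<^typ>\<open>nat \<Rightarrow> nat \<Rightarrow> real\<close>.  A minor of order \<open>k\<close> is determined by
  row indices \<open>I 0 < \<dots> < I (k - 1)\<close> and column indices \<open>J 0 < \<dots> < J (k - 1)\<close>;
  the values of \<open>I\<close> and \<open>J\<close> outside \<open>{..<k}\<close> are irrelevant.
  The minor of order \<open>0\<close> is \<open>1\<close>.
\<close>

definition minor :: "(nat \<Rightarrow> nat \<Rightarrow> real) \<Rightarrow> nat \<Rightarrow> (nat \<Rightarrow> nat) \<Rightarrow> (nat \<Rightarrow> nat) \<Rightarrow> real" where
  "minor M k I J = det (mat k k (\<lambda>(a, b). M (I a) (J b)))"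

definition TP :: "nat \<Rightarrow> (nat \<Rightarrow> nat \<Rightarrow> real) \<Rightarrow> bool" where
  "TP r M \<longleftrightarrow>
     (\<forall>k \<le> r. \<forall>I J. strict_mono_on {..<k} I \<and> strict_mono_on {..<k} J \<longrightarrow> minor M k I J \<ge> 0)"

definition toeplitz :: "real fps \<Rightarrow> nat \<Rightarrow> nat \<Rightarrow> real" where
  "toeplitz a i j = (if j \<le> i then a $ (i - j) else 0)"

definition PF :: "nat \<Rightarrow> real fps \<Rightarrow> bool" where
  "PF r a \<longleftrightarrow> TP r (toeplitz a)"

section \<open>Bivariate generating functions\<close>

text \<open>
  Series in \<open>t\<close> whose coefficients are polynomials in \<open>q\<close> have type
  \<^typ>\<open>real poly fps\<close>.  The library series \<^const>\<open>fps_exp\<close>, \<^const>\<open>fps_ln\<close> and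
  \<^const>\<open>inverse\<close> are not available over that coefficient ring, so the series
  \<open>exp (q u)\<close>, \<open>log (1 - q u)\<close> and \<open>1 / (1 - q u)\<close> in \<open>u\<close> are written out and then composed
  with \<open>u = f(t)\<close>.  The lemmas at the end of this section confirm that specializing \<open>q\<close> to a
  real number yields the library series.
\<close>

definition fps_lift :: "real fps \<Rightarrow> real poly fps" where
  "fps_lift f = Abs_fps (\<lambda>n. [:f $ n:])"

definition exp_q :: "real fps \<Rightarrow> real poly fps" where
  "exp_q f = Abs_fps (\<lambda>n. monom (1 / fact n) n) oo fps_lift f"

definition log_one_minus_q :: "real fps \<Rightarrow> real poly fps" where
  "log_one_minus_q f = Abs_fps (\<lambda>n. if n = 0 then 0 else monom (- 1 / real n) n) oo fps_lift f"

definition inverse_one_minus_q :: "real fps \<Rightarrow> real poly fps" where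
  "inverse_one_minus_q f = Abs_fps (\<lambda>n. monom 1 n) oo fps_lift f"

lemma poly_fps_mult:
  "poly ((F * G) $ n) (q :: real) =
     (Abs_fps (\<lambda>n. poly (F $ n) q) * Abs_fps (\<lambda>n. poly (G $ n) q)) $ n"
  by (simp add: fps_mult_nth poly_sum)

lemma fps_lift_power: "fps_lift f ^ k = fps_lift (f ^ k)"
proof (induction k)
  case 0
  show ?case by (rule fps_ext) (simp add: fps_lift_def fps_one_nth one_pCons)
next
  case (Suc k)
  have "(fps_lift f * fps_lift (f ^ k)) $ n = fps_lift (f * f ^ k) $ n" for n
    by (rule poly_eqI)
       (simp add: fps_lift_def fps_mult_nth coeff_sum coeff_pCons mult.commute split: nat.split)
  then show ?case
    by (simp add: fps_ext Suc.IH)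
qed

lemma poly_compose_fps_lift:
  "poly ((F oo fps_lift f) $ n) q = (Abs_fps (\<lambda>n. poly (F $ n) q) oo f) $ n"
  unfolding fps_compose_nth fps_lift_power
  by (simp add: poly_sum fps_lift_def mult.commute)

lemma poly_exp_q:
  "poly ((fps_lift g * exp_q f) $ n) q = (g * (fps_exp q oo f)) $ n"
proof -
  have "Abs_fps (\<lambda>n. poly (fps_lift g $ n) q) = g"
    by (simp add: fps_lift_def fps_eq_iff)
  moreover have "Abs_fps (\<lambda>n. poly (exp_q f $ n) q) = fps_exp q oo f"
    by (rule fps_ext)
       (simp add: exp_q_def poly_compose_fps_lift poly_monom fps_exp_def)
  ultimately show ?thesis by (simp add: poly_fps_mult)
qed

lemma poly_log_one_minus_q:
  assumes "f $ 0 = 0"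
  shows "poly (log_one_minus_q f $ n) q = (fps_ln 1 oo (- (fps_const q * f))) $ n"
proof -
  have eq: "poly (if i = 0 then 0 else monom (- 1 / real i) i) q * f ^ i $ n =
        fps_ln 1 $ i * (- (fps_const q * f)) ^ i $ n" for i
  proof (cases i)
    case (Suc j)
    have "- (fps_const q * f) = fps_const (- q) * f"
      by (simp flip: fps_const_neg)
    then show ?thesis
      by (simp add: Suc fps_ln_def poly_monom power_mult_distrib fps_const_power
            power_minus[of q] del: fps_const_neg power_Suc)
         (simp add: power_Suc flip: power_add mult_2)
  qed (simp add: fps_ln_def)
  show ?thesis
    unfolding log_one_minus_q_def poly_compose_fps_lift
    using eq by (simp add: fps_compose_nth)
qed

lemma poly_inverse_one_minus_q:
  assumes "f $ 0 = 0"
  shows "poly (inverse_one_minus_q f $ n) q = inverse (1 - fps_const q * f) $ n"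
proof -
  have "Abs_fps (\<lambda>n. poly (monom 1 n) q) = inverse (1 - fps_const q * fps_X)"
  proof (rule fps_inverse_unique[symmetric])
    show "(1 - fps_const q * fps_X) * Abs_fps (\<lambda>n. poly (monom 1 n) q) = 1"
    proof (rule fps_ext)
      fix n
      show "((1 - fps_const q * fps_X) * Abs_fps (\<lambda>n. poly (monom 1 n) q)) $ n = 1 $ n"
        by (cases n) (simp_all add: poly_monom left_diff_distrib mult.assoc)
    qed
  qed
  then show ?thesis
    unfolding inverse_one_minus_q_def poly_compose_fps_lift
    using assms by (simp add: fps_inverse_compose fps_compose_sub_distrib fps_compose_mult_distrib)
qed

section \<open>The triangles\<close>

text \<open>
  The arrays are meant for \<open>f(0) = 0\<close>.  The coefficient of \<open>t\<^sup>n\<close> in each generating function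
  has degree at most \<open>n\<close> in \<open>q\<close>, so all four arrays vanish above the diagonal.
\<close>

definition cycle_index_triangle :: "real fps \<Rightarrow> real fps \<Rightarrow> nat \<Rightarrow> nat \<Rightarrow> real" where
  "cycle_index_triangle f g n k = coeff ((fps_lift g * exp_q f) $ n) k"

definition sheffer_triangle :: "real fps \<Rightarrow> real fps \<Rightarrow> nat \<Rightarrow> nat \<Rightarrow> real" where
  "sheffer_triangle f g n k = fact n * coeff ((fps_lift g * exp_q f) $ n) k"

definition logarithmic_triangle :: "real fps \<Rightarrow> nat \<Rightarrow> nat \<Rightarrow> real" where
  "logarithmic_triangle f n k =
     (if n = 0 then (if k = 0 then 1 else 0)
      else - (fact n * coeff (log_one_minus_q f $ n) k))"

definition fractional_triangle :: "real fps \<Rightarrow> nat \<Rightarrow> nat \<Rightarrow> real" where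
  "fractional_triangle f n k =
     (if n = 0 then (if k = 0 then 1 else 0)
      else fact n * coeff (inverse_one_minus_q f $ n) k)"

lemma coeff_compose_fps_lift_monom:
  assumes "\<And>n. F $ n = monom (c n) n"
  shows "coeff ((F oo fps_lift f) $ n) k = (if k \<le> n then c k * f ^ k $ n else 0)"
proof -
  have "coeff ((F oo fps_lift f) $ n) k = (\<Sum>i=0..n. if i = k then c k * f ^ k $ n else 0)"
    unfolding fps_compose_nth fps_lift_power coeff_sum
    by (rule sum.cong) (auto simp: assms fps_lift_def mult.commute[of "monom _ _"])
  then show ?thesis by simp
qed

lemma triangles_lower_triangular:
  assumes "n < k"
  shows "cycle_index_triangle f g n k = 0" "sheffer_triangle f g n k = 0"
    "logarithmic_triangle f n k = 0" "fractional_triangle f n k = 0"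
proof -
  have "coeff (exp_q f $ m) k = 0" if "m \<le> n" for m
    using assms that unfolding exp_q_def
    by (subst coeff_compose_fps_lift_monom[where c = "\<lambda>n. 1 / fact n"]) auto
  then have A: "coeff ((fps_lift g * exp_q f) $ n) k = 0"
    by (simp add: fps_mult_nth coeff_sum fps_lift_def)
  show "cycle_index_triangle f g n k = 0" "sheffer_triangle f g n k = 0"
    by (simp_all add: cycle_index_triangle_def sheffer_triangle_def A)
  show "logarithmic_triangle f n k = 0"
    using assms unfolding logarithmic_triangle_def log_one_minus_q_def
    by (subst coeff_compose_fps_lift_monom[where c = "\<lambda>n. if n = 0 then 0 else - 1 / real n"]) auto
  show "fractional_triangle f n k = 0"
    using assms unfolding fractional_triangle_def inverse_one_minus_q_def
    by (subst coeff_compose_fps_lift_monom[where c = "\<lambda>n. 1"]) auto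
qed

lemma triangles_column_0:
  assumes "n \<ge> 1" "f $ 0 = 0"
  shows "logarithmic_triangle f n 0 = 0" "fractional_triangle f n 0 = 0"
proof -
  show "logarithmic_triangle f n 0 = 0"
    using assms unfolding logarithmic_triangle_def log_one_minus_q_def
    by (subst coeff_compose_fps_lift_monom[where c = "\<lambda>n. if n = 0 then 0 else - 1 / real n"]) auto
  show "fractional_triangle f n 0 = 0"
    using assms unfolding fractional_triangle_def inverse_one_minus_q_def
    by (subst coeff_compose_fps_lift_monom[where c = "\<lambda>n. 1"]) auto
qed

end

theory Submission
  imports Defs
begin

text \<open>
  All four triangles are rescalings of Riordan arrays.  Write \<open>R(g, f)\<close> for the array with entries
  \<open>[t\<^sup>n] g f\<^sup>k\<close>.  Up to multiplying rows and columns by positive numbers, the Sheffer and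
  cycle-index triangles are \<open>R(g, f)\<close>, and the logarithmic and fractional triangles are
  \<open>R(1, f)\<close>.  Such scalings multiply each minor by a positive number.

  Multiplication by \<open>g\<close> and composition with \<open>f\<close> become matrix products: with \<open>T(g)\<close> the Toeplitz
  matrix of \<open>g\<close>, one has \<open>R(g, f) = T(g) R(1, f)\<close> and \<open>R(g(f), f) = R(1, f) T(g)\<close>
  (\<open>riordan_mult\<close>, \<open>riordan_compose\<close>).  By the Cauchy--Binet formula products of TP matrices are TP,
  so everything reduces to the total positivity of \<open>R(1, f)\<close>.

  The array \<open>R(1, f)\<close> has first row and first column \<open>(1, 0, 0, \<dots>)\<close>, and the block that remains after
  deleting them is built from \<open>R(1, f)\<close> itself.  If \<open>f\<close> is PF, then \<open>f\<^sup>k\<^sup>+\<^sup>1 = f f\<^sup>k\<close> exhibits the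
  block as a row-shifted \<open>T(f)\<close> times \<open>R(1, f)\<close>.  If instead \<open>\<phi> = 1 / (f\<^sup>-\<^sup>1)'\<close> is PF, where
  \<open>f\<^sup>-\<^sup>1\<close> is the compositional inverse, then \<open>f' = \<phi>(f)\<close>, and differentiating \<open>f\<^sup>k\<^sup>+\<^sup>1\<close> gives
  \<open>(n + 1) [t\<^sup>n\<^sup>+\<^sup>1] f\<^sup>k\<^sup>+\<^sup>1 = (k + 1) [t\<^sup>n] \<phi>(f) f\<^sup>k\<close>, so that the block is a positive rescaling of
  \<open>R(1, f) T(\<phi>)\<close>.  In both cases row \<open>n + 1\<close> of \<open>R(1, f)\<close> is controlled by the rows up to \<open>n\<close>, and
  induction on the number of rows proves the claim (\<open>TP_riordan_of_PF\<close>, \<open>TP_riordan_of_PF_deriv\<close>).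
\<close>

section \<open>Minors\<close>

lemma minor_leibniz:
  "minor M k I J = (\<Sum>p | p permutes {0..<k}. of_int (sign p) * (\<Prod>a<k. M (I a) (J (p a))))"
proof -
  have *: "(\<Prod>i = 0..<k. mat k k (\<lambda>(a, b). M (I a) (J b)) $$ (i, p i))
      = (\<Prod>a<k. M (I a) (J (p a)))" if "p permutes {0..<k}" for p
  proof (rule prod.cong)
    fix a assume "a \<in> {..<k}"
    moreover from this have "p a < k"
      using permutes_in_image[OF that, of a] by simp
    ultimately show "mat k k (\<lambda>(a, b). M (I a) (J b)) $$ (a, p a) = M (I a) (J (p a))"
      by simp
  qed (rule lessThan_atLeast0[symmetric])
  show ?thesis
    unfolding minor_def det_def'[of "mat k k (\<lambda>(a, b). M (I a) (J b))" k, OF mat_carrier]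
    by (rule sum.cong) (simp_all only: * mem_Collect_eq)
qed

lemma minor_order_0 [simp]: "minor M 0 I J = 1"
  by (simp add: minor_def)

lemma minor_cong:
  assumes "\<And>a b. a < k \<Longrightarrow> b < k \<Longrightarrow> M (I a) (J b) = M' (I' a) (J' b)"
  shows "minor M k I J = minor M' k I' J'"
  unfolding minor_def using assms by (intro arg_cong[where f = det] cong_mat) auto

lemma minor_transpose: "minor (\<lambda>i j. M j i) k J I = minor M k I J"
proof -
  have "mat k k (\<lambda>(a, b). M (I b) (J a)) = transpose_mat (mat k k (\<lambda>(a, b). M (I a) (J b)))"
    by (intro eq_matI) auto
  then show ?thesis
    unfolding minor_def by (simp add: det_transpose[where n = k])
qed

lemma minor_permute_rows:
  assumes "p permutes {0..<k}"
  shows "minor M k (I \<circ> p) J = of_int (sign p) * minor M k I J"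
proof -
  let ?A = "mat k k (\<lambda>(a, b). M (I a) (J b))"
  have "mat k k (\<lambda>(a, b). M ((I \<circ> p) a) (J b)) = mat k k (\<lambda>(a, b). ?A $$ (p a, b))"
    using permutes_in_image[OF assms] by (intro eq_matI) auto
  then show ?thesis
    unfolding minor_def using det_permute_rows[of ?A k p] assms by (simp add: sign_def)
qed

lemma minor_permute_cols:
  assumes "p permutes {0..<k}"
  shows "minor M k I (J \<circ> p) = of_int (sign p) * minor M k I J"
  using minor_permute_rows[OF assms, of "\<lambda>i j. M j i" J I] by (simp add: minor_transpose[of M])

lemma minor_repeated_row:
  assumes "\<not> inj_on I {..<k}"
  shows "minor M k I J = 0"
proof -
  obtain a b where "a < k" "b < k" "a \<noteq> b" "I a = I b"
    using assms by (auto simp: inj_on_def)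
  then show ?thesis
    unfolding minor_def
    by (intro det_identical_rows[of _ k a b]) (auto intro!: eq_vecI)
qed

lemma minor_scale:
  "minor (\<lambda>n k. c n * M n k * d k) k I J = (\<Prod>a<k. c (I a)) * minor M k I J * (\<Prod>b<k. d (J b))"
proof -
  have *: "(\<Prod>a<k. c (I a) * M (I a) (J (p a)) * d (J (p a)))
      = (\<Prod>a<k. c (I a)) * (\<Prod>a<k. M (I a) (J (p a))) * (\<Prod>b<k. d (J b))"
    if "p permutes {0..<k}" for p
    using prod.permute[of p "{..<k}" "\<lambda>b. d (J b)"] that
    by (simp add: prod.distrib lessThan_atLeast0 comp_def)
  show ?thesis
    unfolding minor_leibniz sum_distrib_left sum_distrib_right
  proof (intro sum.cong refl)
    fix p assume "p \<in> {p. p permutes {0..<k}}"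
    then have p: "p permutes {0..<k}" by simp
    show "of_int (sign p) * (\<Prod>a<k. c (I a) * M (I a) (J (p a)) * d (J (p a)))
        = (\<Prod>a<k. c (I a)) * (of_int (sign p) * (\<Prod>a<k. M (I a) (J (p a)))) * (\<Prod>b<k. d (J b))"
      unfolding *[OF p] by (simp only: mult_ac)
  qed
qed

lemma minor_zero_row:
  assumes "a < k" "\<And>b. b < k \<Longrightarrow> M (I a) (J b) = 0"
  shows "minor M k I J = 0"
proof -
  have "(\<Prod>a<k. M (I a) (J (p a))) = 0" if "p permutes {0..<k}" for p
    using assms permutes_in_image[OF that, of a] by (intro prod_zero) auto
  then show ?thesis
    unfolding minor_leibniz by (intro sum.neutral) auto
qed

lemma minor_zero_col:
  assumes "b < k" "\<And>a. a < k \<Longrightarrow> M (I a) (J b) = 0"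
  shows "minor M k I J = 0"
  using minor_zero_row[of b k "\<lambda>i j. M j i" J I] assms by (simp add: minor_transpose[of M])

lemma minor_expand_first_row:
  assumes "\<And>b. 0 < b \<Longrightarrow> b < Suc k \<Longrightarrow> M (I 0) (J b) = 0"
  shows "minor M (Suc k) I J = M (I 0) (J 0) * minor M k (\<lambda>a. I (Suc a)) (\<lambda>b. J (Suc b))"
proof -
  let ?A = "mat (Suc k) (Suc k) (\<lambda>(a, b). M (I a) (J b))"
  have "mat_delete ?A 0 0 = mat k k (\<lambda>(a, b). M (I (Suc a)) (J (Suc b)))"
    unfolding mat_delete_def by (intro eq_matI) auto
  moreover have "det ?A = (\<Sum>j<Suc k. ?A $$ (0, j) * cofactor ?A 0 j)"
    by (rule laplace_expansion_row) auto
  moreover have "\<dots> = ?A $$ (0, 0) * cofactor ?A 0 0"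
    by (rule sum.remove[of _ 0, THEN trans]) (auto intro!: sum.neutral simp: assms)
  ultimately show ?thesis
    by (simp add: minor_def cofactor_def)
qed

text \<open>
  Minors with unordered row indices, which occur in the product formula below, are brought back to
  genuine minors by this permutation, at the cost of a sign.
\<close>

lemma sorting_permutation:
  fixes \<phi> :: "nat \<Rightarrow> nat"
  assumes inj: "inj_on \<phi> {..<k}"
  obtains p where "p permutes {0..<k}" "strict_mono_on {..<k} (\<phi> \<circ> p)"
proof -
  have card: "card (\<phi> ` {..<k}) = k"
    using inj by (simp add: card_image)
  obtain h where h: "bij_betw h {..<k} (\<phi> ` {..<k})" "strict_mono_on {..<k} h"
    using ex_bij_betw_strict_mono_card[of "\<phi> ` {..<k}"] unfolding card by auto
  define p where "p a = (if a < k then inv_into {..<k} \<phi> (h a) else a)" for a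
  have "bij_betw (inv_into {..<k} \<phi> \<circ> h) {..<k} {..<k}"
    using h(1) inj by (intro bij_betw_trans[OF h(1)] bij_betw_inv_into) (simp add: bij_betw_def)
  then have "bij_betw p {0..<k} {0..<k}"
    by (subst bij_betw_cong[of _ _ "inv_into {..<k} \<phi> \<circ> h"]) (auto simp: p_def lessThan_atLeast0)
  then have "p permutes {0..<k}"
    by (rule bij_imp_permutes) (simp add: p_def)
  moreover have "(\<phi> \<circ> p) a = h a" if "a < k" for a
    using that h(1) by (auto simp: p_def bij_betw_def intro!: f_inv_into_f)
  then have "strict_mono_on {..<k} (\<phi> \<circ> p)"
    using h(2) by (simp add: strict_mono_on_def)
  ultimately show ?thesis by (rule that)
qed

text \<open>
  This is the Cauchy--Binet formula, with the sum running over all index maps instead of the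
  increasing ones.  Each \<open>k\<close>-subset of the inner indices is then counted \<open>k!\<close> times, since both
  factors change by the same sign when the map is permuted; hence the factor \<open>fact k\<close>.  In this form
  no sum over subsets is needed: expanding the rows of the product by multilinearity gives a sum over
  maps \<open>\<phi>\<close> of a monomial in \<open>A\<close> times a minor of \<open>B\<close>, and averaging it over the reindexings
  \<open>\<phi> \<circ> p\<close> assembles the monomials into minors of \<open>A\<close>.
\<close>

lemma minor_product:
  fixes A B C :: "nat \<Rightarrow> nat \<Rightarrow> real"
  assumes C: "\<And>a b. a < k \<Longrightarrow> b < k \<Longrightarrow> C (I a) (J b) = (\<Sum>m<N. A (I a) m * B m (J b))"
  shows "fact k * minor C k I J = (\<Sum>\<phi>\<in>{..<k} \<rightarrow>\<^sub>E {..<N}. minor A k I \<phi> * minor B k \<phi> J)"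
proof -
  let ?E = "{..<k} \<rightarrow>\<^sub>E {..<N}" and ?P = "{p. p permutes {0..<k}}"
  let ?F = "\<lambda>\<phi>. (\<Prod>a<k. A (I a) (\<phi> a)) * minor B k \<phi> J"
  have "minor C k I J
      = (\<Sum>p\<in>?P. of_int (sign p) * (\<Prod>a<k. \<Sum>m<N. A (I a) m * B m (J (p a))))"
    unfolding minor_leibniz
  proof (intro sum.cong refl arg_cong2[where f = "(*)"] prod.cong)
    fix p a assume "p \<in> ?P" "a \<in> {..<k}"
    then have "p a < k"
      using permutes_in_image[of p "{0..<k}" a] by auto
    then show "C (I a) (J (p a)) = (\<Sum>m<N. A (I a) m * B m (J (p a)))"
      using \<open>a \<in> {..<k}\<close> by (intro C) auto
  qed
  also have "\<dots> = (\<Sum>p\<in>?P. \<Sum>\<phi>\<in>?E. of_int (sign p) *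
      ((\<Prod>a<k. A (I a) (\<phi> a)) * (\<Prod>a<k. B (\<phi> a) (J (p a)))))"
    by (simp add: prod_sum_PiE prod.distrib sum_distrib_left)
  also have "\<dots> = (\<Sum>\<phi>\<in>?E. ?F \<phi>)"
    by (subst sum.swap) (simp add: minor_leibniz[of B] sum_distrib_left mult_ac)
  finally have expand: "minor C k I J = (\<Sum>\<phi>\<in>?E. ?F \<phi>)" .
  \<comment> \<open>A permutation of the positions permutes the index maps among themselves.\<close>
  have reindex: "(\<Sum>\<phi>\<in>?E. ?F \<phi>) = (\<Sum>\<phi>\<in>?E. ?F (\<phi> \<circ> p))" if p: "p permutes {0..<k}" for p
  proof (rule sum.reindex_bij_witness[of _ "\<lambda>\<phi>. \<phi> \<circ> p" "\<lambda>\<phi>. \<phi> \<circ> inv_into UNIV p"])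
    have closed: "\<phi> \<circ> q \<in> ?E" if "\<phi> \<in> ?E" "q permutes {0..<k}" for \<phi> q
      using that permutes_in_image[OF that(2)]
      by (auto simp: PiE_def Pi_def extensional_def)
    show "\<phi> \<circ> inv_into UNIV p \<in> ?E" "\<phi> \<circ> p \<in> ?E" if "\<phi> \<in> ?E" for \<phi>
      using that p permutes_inv[OF p] closed by blast+
  qed (use permutes_inv_o[OF p] in \<open>auto simp: comp_assoc\<close>)
  have "fact k * minor C k I J = (\<Sum>p\<in>?P. minor C k I J)"
    by (simp add: card_permutations[of _ k])
  also have "\<dots> = (\<Sum>p\<in>?P. \<Sum>\<phi>\<in>?E. ?F (\<phi> \<circ> p))"
    using expand reindex by (intro sum.cong) auto
  also have "\<dots> = (\<Sum>\<phi>\<in>?E. \<Sum>p\<in>?P. ?F (\<phi> \<circ> p))"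
    by (rule sum.swap)
  also have "\<dots> = (\<Sum>\<phi>\<in>?E. minor A k I \<phi> * minor B k \<phi> J)"
    by (simp add: minor_permute_rows minor_leibniz[of A] sum_distrib_left sum_distrib_right mult_ac)
  finally show ?thesis .
qed

section \<open>Total positivity of the first rows\<close>

text \<open>
  Only the row indices are bounded.  This suffices for an induction on rows: the first \<open>N\<close> rows of a
  product are determined by the first \<open>N\<close> rows of a lower triangular left factor and of the right
  factor.
\<close>

definition TP_below :: "nat \<Rightarrow> nat \<Rightarrow> (nat \<Rightarrow> nat \<Rightarrow> real) \<Rightarrow> bool" where
  "TP_below N r M \<longleftrightarrow>
     (\<forall>k \<le> r. \<forall>I J. strict_mono_on {..<k} I \<and> strict_mono_on {..<k} J \<and> (\<forall>a<k. I a < N)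
        \<longrightarrow> minor M k I J \<ge> 0)"

lemma TP_belowI:
  assumes "\<And>k I J. k \<le> r \<Longrightarrow> strict_mono_on {..<k} I \<Longrightarrow> strict_mono_on {..<k} J
    \<Longrightarrow> (\<And>a. a < k \<Longrightarrow> I a < N) \<Longrightarrow> minor M k I J \<ge> 0"
  shows "TP_below N r M"
  using assms unfolding TP_below_def by blast

lemma TP_belowD:
  assumes "TP_below N r M" "k \<le> r" "strict_mono_on {..<k} I" "strict_mono_on {..<k} J"
    "\<And>a. a < k \<Longrightarrow> I a < N"
  shows "minor M k I J \<ge> 0"
  using assms unfolding TP_below_def by blast

lemma TP_iff_TP_below: "TP r M \<longleftrightarrow> (\<forall>N. TP_below N r M)"
proof (intro iffI allI)
  fix N assume "TP r M"
  then show "TP_below N r M"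
    by (intro TP_belowI) (simp add: TP_def)
next
  assume *: "\<forall>N. TP_below N r M"
  show "TP r M"
    unfolding TP_def
  proof (intro allI impI, elim conjE)
    fix k and I J :: "nat \<Rightarrow> nat"
    assume k: "k \<le> r" and IJ: "strict_mono_on {..<k} I" "strict_mono_on {..<k} J"
    have "I a < Suc (\<Sum>a<k. I a)" if "a < k" for a
      using that by (intro le_imp_less_Suc member_le_sum) simp_all
    then show "minor M k I J \<ge> 0"
      by (rule TP_belowD[OF *[THEN spec] k IJ])
  qed
qed

lemma TP_mono: "TP r M \<Longrightarrow> r' \<le> r \<Longrightarrow> TP r' M"
  unfolding TP_def by (meson order_trans)

lemma TP_shift_rows:
  assumes "TP r M"
  shows "TP r (\<lambda>n. M (Suc n))"
  unfolding TP_def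
proof (intro allI impI, elim conjE)
  fix k and I J :: "nat \<Rightarrow> nat"
  assume k: "k \<le> r" and I: "strict_mono_on {..<k} I" and J: "strict_mono_on {..<k} J"
  have "strict_mono_on {..<k} (\<lambda>a. Suc (I a))"
    using I by (simp add: strict_mono_on_def)
  then have "minor M k (\<lambda>a. Suc (I a)) J \<ge> 0"
    using assms k J by (simp add: TP_def)
  then show "minor (\<lambda>n. M (Suc n)) k I J \<ge> 0"
    by (simp add: minor_def)
qed

lemma TP_below_scale:
  assumes M: "TP_below N r M" and c: "\<And>n. c n \<ge> 0" and d: "\<And>k. d k \<ge> 0"
  shows "TP_below N r (\<lambda>n k. c n * M n k * d k)"
proof (rule TP_belowI)
  fix k and I J :: "nat \<Rightarrow> nat"
  assume "k \<le> r" "strict_mono_on {..<k} I" "strict_mono_on {..<k} J" "\<And>a. a < k \<Longrightarrow> I a < N"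
  then have "minor M k I J \<ge> 0"
    by (rule TP_belowD[OF M])
  moreover have "(\<Prod>a<k. c (I a)) \<ge> 0" "(\<Prod>b<k. d (J b)) \<ge> 0"
    by (simp_all add: c d prod_nonneg)
  ultimately show "minor (\<lambda>n k. c n * M n k * d k) k I J \<ge> 0"
    by (subst minor_scale[of c M d k I J]) simp
qed

lemma TP_scale:
  assumes M: "TP r M" and cd: "\<And>n. c n \<ge> 0" "\<And>k. d k \<ge> 0"
  shows "TP r (\<lambda>n k. c n * M n k * d k)"
  unfolding TP_iff_TP_below
proof
  fix N
  show "TP_below N r (\<lambda>n k. c n * M n k * d k)"
    using M by (intro TP_below_scale cd) (simp add: TP_iff_TP_below)
qed

text \<open>
  In the Cauchy--Binet sum, a map with a repeated value contributes \<open>0\<close>.  For an injective map, sorting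
  it multiplies the minors of both factors by the same sign, so each term is a product of two
  nonnegative minors.
\<close>

lemma TP_below_product:
  assumes A: "TP_below N r A" and B: "TP_below N r B"
    and C: "\<And>n k. n < N \<Longrightarrow> C n k = (\<Sum>m<N. A n m * B m k)"
  shows "TP_below N r C"
proof (rule TP_belowI)
  fix k and I J :: "nat \<Rightarrow> nat"
  assume k: "k \<le> r" and J: "strict_mono_on {..<k} J"
    and I: "strict_mono_on {..<k} I" "\<And>a. a < k \<Longrightarrow> I a < N"
  have "minor A k I \<phi> * minor B k \<phi> J \<ge> 0" if \<phi>: "\<phi> \<in> {..<k} \<rightarrow>\<^sub>E {..<N}" for \<phi>
  proof (cases "inj_on \<phi> {..<k}")
    case True
    then obtain p where p: "p permutes {0..<k}" "strict_mono_on {..<k} (\<phi> \<circ> p)"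
      by (rule sorting_permutation)
    have "(\<phi> \<circ> p) a < N" if "a < k" for a
      using \<phi> that permutes_in_image[OF p(1), of a] by auto
    then have "minor B k (\<phi> \<circ> p) J \<ge> 0"
      by (rule TP_belowD[OF B k p(2) J])
    moreover have "minor A k I (\<phi> \<circ> p) \<ge> 0"
      using I by (intro TP_belowD[OF A k _ p(2)])
    ultimately have "0 \<le> minor A k I (\<phi> \<circ> p) * minor B k (\<phi> \<circ> p) J"
      by simp
    also have "\<dots> = minor A k I \<phi> * minor B k \<phi> J"
      unfolding minor_permute_rows[OF p(1)] minor_permute_cols[OF p(1)] by (simp add: sign_def)
    finally show ?thesis .
  qed (simp add: minor_repeated_row)
  then have "fact k * minor C k I J \<ge> 0"
    using I by (subst minor_product[where A = A and B = B and N = N]) (auto intro!: sum_nonneg C)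
  then show "minor C k I J \<ge> 0"
    using zero_le_mult_iff[of "fact k" "minor C k I J"] fact_gt_zero[of k, where 'a = real]
    by linarith
qed

text \<open>
  A nonzero minor of the direct sum of a scalar and a matrix either uses both the first row and the first
  column, and then it splits off the scalar, or uses neither, and then it is a minor of the inner
  block.
\<close>

lemma TP_below_border:
  assumes corner: "M 0 0 \<ge> 0" and row: "\<And>k. M 0 (Suc k) = 0" and col: "\<And>n. M (Suc n) 0 = 0"
    and M: "TP_below N r (\<lambda>n k. M (Suc n) (Suc k))"
  shows "TP_below (Suc N) r M"
proof (rule TP_belowI)
  fix k and I J :: "nat \<Rightarrow> nat"
  assume k: "k \<le> r" and J: "strict_mono_on {..<k} J"
    and I: "strict_mono_on {..<k} I" "\<And>a. a < k \<Longrightarrow> I a < Suc N"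
  have inner: "minor M l I' J' \<ge> 0"
    if "l \<le> r" "strict_mono_on {..<l} I'" "strict_mono_on {..<l} J'"
      "\<And>a. a < l \<Longrightarrow> 0 < I' a \<and> I' a < Suc N" "\<And>b. b < l \<Longrightarrow> 0 < J' b" for l I' J'
  proof -
    have "minor M l I' J' = minor (\<lambda>n k. M (Suc n) (Suc k)) l (\<lambda>a. I' a - 1) (\<lambda>b. J' b - 1)"
      using that(4,5) by (intro minor_cong) auto
    also have "strict_mono_on {..<l} (\<lambda>a. I' a - 1)" "strict_mono_on {..<l} (\<lambda>b. J' b - 1)"
      using that by (auto simp: strict_mono_on_def intro!: diff_less_mono Suc_leI)
    then have "minor (\<lambda>n k. M (Suc n) (Suc k)) l (\<lambda>a. I' a - 1) (\<lambda>b. J' b - 1) \<ge> 0"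
    proof (rule TP_belowD[OF M that(1)])
      show "I' a - 1 < N" if "a < l" for a
        using \<open>\<And>a. a < l \<Longrightarrow> 0 < I' a \<and> I' a < Suc N\<close>[OF that] by linarith
    qed
    finally show ?thesis .
  qed
  have row0: "M 0 j = 0" if "0 < j" for j
    using row that by (cases j) auto
  have col0: "M i 0 = 0" if "0 < i" for i
    using col that by (cases i) auto
  show "minor M k I J \<ge> 0"
  proof (cases k)
    case (Suc l)
    have I_pos: "0 < I a" if "0 < a" "a < k" for a
      using strict_mono_onD[OF I(1), of 0 a] that by auto
    have J_pos: "0 < J b" if "0 < b" "b < k" for b
      using strict_mono_onD[OF J, of 0 b] that by auto
    consider "I 0 = 0" "J 0 = 0" | "I 0 = 0" "0 < J 0" | "0 < I 0" "J 0 = 0" | "0 < I 0" "0 < J 0"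
      by blast
    then show ?thesis
    proof cases
      case 1
      have "minor M k I J = M 0 0 * minor M l (\<lambda>a. I (Suc a)) (\<lambda>b. J (Suc b))"
        unfolding Suc using J_pos 1
        by (subst minor_expand_first_row) (simp_all add: Suc row0)
      moreover have "minor M l (\<lambda>a. I (Suc a)) (\<lambda>b. J (Suc b)) \<ge> 0"
        using k I J I_pos J_pos Suc by (intro inner) (auto simp: strict_mono_on_def)
      ultimately show ?thesis
        using corner by simp
    next
      case 2
      then have "0 < J b" if "b < k" for b
        using J_pos that by (cases b) auto
      then have "minor M k I J = 0"
        using row0 2 Suc by (intro minor_zero_row[of 0]) auto
      then show ?thesis by simp
    next
      case 3
      then have "0 < I a" if "a < k" for a
        using I_pos that by (cases a) auto
      then have "minor M k I J = 0"
        using col0 3 Suc by (intro minor_zero_col[of 0]) auto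
      then show ?thesis by simp
    next
      case 4
      then show ?thesis
        using k I J I_pos J_pos by (intro inner) (metis gr0I)+
    qed
  qed simp
qed

section \<open>Riordan arrays\<close>

definition riordan :: "real fps \<Rightarrow> real fps \<Rightarrow> nat \<Rightarrow> nat \<Rightarrow> real" where
  "riordan g f n k = (g * f ^ k) $ n"

lemma riordan_mult:
  assumes "n < N"
  shows "riordan (g * h) f n k = (\<Sum>m<N. toeplitz g n m * riordan h f m k)"
proof -
  have "riordan (g * h) f n k = ((h * f ^ k) * g) $ n"
    by (simp add: riordan_def mult_ac)
  also have "\<dots> = (\<Sum>m\<le>n. toeplitz g n m * riordan h f m k)"
    unfolding fps_mult_nth[of "h * f ^ k" g] atLeast0AtMost
    by (intro sum.cong) (auto simp: toeplitz_def riordan_def)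
  also have "\<dots> = (\<Sum>m<N. toeplitz g n m * riordan h f m k)"
    using assms by (intro sum.mono_neutral_left) (auto simp: toeplitz_def)
  finally show ?thesis .
qed

text \<open>
  Since \<open>g(f) f\<^sup>k\<close> is the composition of \<open>g t\<^sup>k\<close> with \<open>f\<close>, its expansion in powers of \<open>f\<close> has the
  \<open>k\<close>-th column of the Toeplitz matrix of \<open>g\<close> as coefficients.
\<close>

lemma riordan_compose:
  assumes f: "f $ 0 = 0" and "n < N"
  shows "riordan (g oo f) f n k = (\<Sum>m<N. riordan 1 f n m * toeplitz g m k)"
proof -
  have "(g oo f) * f ^ k = (g * fps_X ^ k) oo f"
    using f by (simp add: fps_compose_mult_distrib flip: fps_compose_power)
  then have "riordan (g oo f) f n k = (\<Sum>m\<le>n. riordan 1 f n m * toeplitz g m k)"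
    unfolding riordan_def
    by (auto simp: fps_compose_nth toeplitz_def fps_X_power_mult_right_nth atLeast0AtMost
        intro!: sum.cong)
  also have "\<dots> = (\<Sum>m<N. riordan 1 f n m * toeplitz g m k)"
    using assms startsby_zero_power_prefix[OF f]
    by (intro sum.mono_neutral_left) (auto simp: riordan_def)
  finally show ?thesis .
qed

lemma TP_riordan_mult:
  assumes "PF r g" "TP r (riordan h f)"
  shows "TP r (riordan (g * h) f)"
  unfolding TP_iff_TP_below
proof
  fix N
  have "TP_below N r (toeplitz g)" "TP_below N r (riordan h f)"
    using assms by (simp_all add: PF_def TP_iff_TP_below)
  then show "TP_below N r (riordan (g * h) f)"
    by (rule TP_below_product[OF _ _ riordan_mult])
qed

lemma TP_riordan_compose:
  assumes "f $ 0 = 0" "PF r g" "TP r (riordan 1 f)"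
  shows "TP r (riordan (g oo f) f)"
  unfolding TP_iff_TP_below
proof
  fix N
  have "TP_below N r (riordan 1 f)" "TP_below N r (toeplitz g)"
    using assms by (simp_all add: PF_def TP_iff_TP_below)
  then show "TP_below N r (riordan (g oo f) f)"
    by (rule TP_below_product[OF _ _ riordan_compose[OF assms(1)]])
qed

text \<open>
  Both sufficient conditions for the total positivity of \<open>riordan 1 f\<close> share this induction.  The
  array is the direct sum of the entry \<open>1\<close> and the block of the hypothesis, so total positivity of the
  first \<open>N\<close> rows of the block is total positivity of the first \<open>N + 1\<close> rows of the array.
\<close>

lemma TP_riordan_induct:
  assumes f: "f $ 0 = 0"
    and step: "\<And>N. TP_below N r (riordan 1 f)
      \<Longrightarrow> TP_below N r (\<lambda>n k. riordan 1 f (Suc n) (Suc k))"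
  shows "TP r (riordan 1 f)"
proof -
  have "TP_below N r (riordan 1 f)" for N
  proof (induction N)
    case 0
    show ?case
    proof (rule TP_belowI)
      fix k and I J :: "nat \<Rightarrow> nat"
      assume "\<And>a. a < k \<Longrightarrow> I a < 0"
      then have "k = 0" by (metis gr0I not_less_zero)
      then show "minor (riordan 1 f) k I J \<ge> 0" by simp
    qed
  next
    case (Suc N)
    show ?case
      by (intro TP_below_border step Suc.IH) (simp_all add: riordan_def f)
  qed
  then show ?thesis
    by (simp add: TP_iff_TP_below)
qed

lemma TP_riordan_of_PF:
  assumes f: "f $ 0 = 0" and PF: "PF r f"
  shows "TP r (riordan 1 f)"
proof (rule TP_riordan_induct[OF f])
  fix N assume IH: "TP_below N r (riordan 1 f)"
  have "TP_below N r (\<lambda>n. toeplitz f (Suc n))"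
    using TP_shift_rows PF by (auto simp: PF_def TP_iff_TP_below)
  then show "TP_below N r (\<lambda>n k. riordan 1 f (Suc n) (Suc k))"
  proof (rule TP_below_product[OF _ IH])
    fix n k assume "n < N"
    have "riordan 1 f (Suc n) (Suc k) = riordan (f * 1) f (Suc n) k"
      by (simp add: riordan_def)
    also have "\<dots> = (\<Sum>m<Suc (Suc n). toeplitz f (Suc n) m * riordan 1 f m k)"
      by (rule riordan_mult) simp
    \<comment> \<open>Row \<open>n + 1\<close> of the Toeplitz matrix has its last entry \<open>f(0) = 0\<close> in column \<open>n + 1\<close>, so row
      \<open>n + 1\<close> of the array depends on rows up to \<open>n < N\<close> only.\<close>
    also have "\<dots> = (\<Sum>m<N. toeplitz f (Suc n) m * riordan 1 f m k)"
    proof (rule sum.mono_neutral_cong)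
      fix m assume "m \<in> {..<Suc (Suc n)} - {..<N}"
      then have "m = Suc n" using \<open>n < N\<close> by auto
      then show "toeplitz f (Suc n) m * riordan 1 f m k = 0"
        using f by (simp add: toeplitz_def)
    qed (auto simp: toeplitz_def)
    finally show "riordan 1 f (Suc n) (Suc k)
      = (\<Sum>m<N. toeplitz f (Suc n) m * riordan 1 f m k)" .
  qed
qed

text \<open>
  Here multiplying by the Toeplitz matrix on the right replaces the factor \<open>f\<close> of \<open>f\<^sup>k\<^sup>+\<^sup>1\<close> by
  \<open>\<phi>(f) = f'\<close>, and the derivative of \<open>f\<^sup>k\<^sup>+\<^sup>1\<close> lowers the row index by one; the factors \<open>n + 1\<close> and
  \<open>k + 1\<close> from differentiation are absorbed in the scaling.
\<close>

lemma TP_riordan_of_PF_deriv: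
  assumes f: "f $ 0 = 0" and deriv: "fps_deriv f = \<phi> oo f" and PF: "PF r \<phi>"
  shows "TP r (riordan 1 f)"
proof (rule TP_riordan_induct[OF f])
  fix N assume IH: "TP_below N r (riordan 1 f)"
  have "TP_below N r (toeplitz \<phi>)"
    using PF by (simp add: PF_def TP_iff_TP_below)
  then have "TP_below N r (riordan (\<phi> oo f) f)"
    by (rule TP_below_product[OF IH _ riordan_compose[OF f]])
  then have "TP_below N r (\<lambda>n k. 1 / real (Suc n) * riordan (\<phi> oo f) f n k * real (Suc k))"
    by (rule TP_below_scale) auto
  moreover have "riordan 1 f (Suc n) (Suc k)
      = 1 / real (Suc n) * riordan (\<phi> oo f) f n k * real (Suc k)" for n k
  proof -
    have "real (Suc n) * f ^ Suc k $ Suc n = fps_deriv (f ^ Suc k) $ n"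
      unfolding fps_deriv_nth by simp
    also have "\<dots> = real (Suc k) * riordan (\<phi> oo f) f n k"
    proof -
      have "fps_deriv (f ^ Suc k) = fps_const (real (Suc k)) * ((\<phi> oo f) * f ^ k)"
        unfolding fps_deriv_power deriv by (simp add: mult_ac del: of_nat_Suc)
      then show ?thesis
        by (simp only: riordan_def fps_mult_left_const_nth)
    qed
    finally show ?thesis
      by (simp add: riordan_def field_simps del: of_nat_Suc)
  qed
  ultimately show "TP_below N r (\<lambda>n k. riordan 1 f (Suc n) (Suc k))"
    by simp
qed

text \<open>
  By the chain rule applied to the identity that the compositional inverse of \<open>f\<close>, evaluated at \<open>f\<close>,
  is \<open>t\<close>.  This turns the condition on the compositional inverse into a differential equation for
  \<open>f\<close>.
\<close>

lemma fps_deriv_eq_compose_inv: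
  fixes f :: "real fps"
  assumes "f $ 0 = 0" "f $ 1 \<noteq> 0"
  shows "fps_deriv f = inverse (fps_deriv (fps_inv f)) oo f"
proof -
  have "(fps_deriv (fps_inv f) oo f) * fps_deriv f = fps_deriv (fps_inv f oo f)"
    using assms by (simp add: fps_compose_deriv)
  also have "\<dots> = 1"
    using assms by (simp add: fps_inv)
  finally have *: "(fps_deriv (fps_inv f) oo f) * fps_deriv f = 1" .
  then have "fps_deriv (fps_inv f) $ 0 \<noteq> 0"
    by (metis fps_compose_nth_0 fps_mult_nth_0 fps_one_nth mult_zero_left zero_neq_one)
  with * assms show ?thesis
    by (simp add: fps_inverse_compose fps_inverse_unique)
qed

section \<open>The triangles as scaled Riordan arrays\<close>

text \<open>
  The trivial scaling factors \<open>1\<close> below keep the right-hand sides in the form to which \<open>TP_scale\<close>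
  applies.
\<close>

lemma cycle_index_triangle_eq:
  assumes "f $ 0 = 0"
  shows "cycle_index_triangle f g n k = 1 * riordan g f n k * (1 / fact k)"
proof -
  have "coeff (exp_q f $ m) k = f ^ k $ m / fact k" for m
    using startsby_zero_power_prefix[OF assms, of k] unfolding exp_q_def
    by (subst coeff_compose_fps_lift_monom[where c = "\<lambda>n. 1 / fact n"]) auto
  then show ?thesis
    by (simp add: cycle_index_triangle_def riordan_def fps_mult_nth coeff_sum fps_lift_def
        sum_divide_distrib)
qed

lemma sheffer_triangle_eq:
  assumes "f $ 0 = 0"
  shows "sheffer_triangle f g n k = fact n * riordan g f n k * (1 / fact k)"
  using cycle_index_triangle_eq[OF assms, of g n k]
  by (simp add: sheffer_triangle_def cycle_index_triangle_def)

text \<open>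
  The value \<open>1\<close> of the scaling factor at \<open>k = 0\<close> matches the convention that the entry at \<open>(0, 0)\<close>
  is \<open>1\<close>; below it, column \<open>0\<close> of the Riordan array vanishes.
\<close>

lemma logarithmic_triangle_eq:
  assumes "f $ 0 = 0"
  shows "logarithmic_triangle f n k = fact n * riordan 1 f n k * (if k = 0 then 1 else 1 / real k)"
proof (cases "n = 0")
  case True
  then show ?thesis
    using assms by (simp add: logarithmic_triangle_def riordan_def fps_power_zeroth)
next
  case False
  then show ?thesis
    using startsby_zero_power_prefix[OF assms, of k]
    unfolding logarithmic_triangle_def log_one_minus_q_def riordan_def
    by (subst coeff_compose_fps_lift_monom[where c = "\<lambda>n. if n = 0 then 0 else - 1 / real n"]) auto
qed

lemma fractional_triangle_eq:
  assumes "f $ 0 = 0"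
  shows "fractional_triangle f n k = fact n * riordan 1 f n k * 1"
proof (cases "n = 0")
  case True
  then show ?thesis
    using assms by (simp add: fractional_triangle_def riordan_def fps_power_zeroth)
next
  case False
  then show ?thesis
    using startsby_zero_power_prefix[OF assms, of k]
    unfolding fractional_triangle_def inverse_one_minus_q_def riordan_def
    by (subst coeff_compose_fps_lift_monom[where c = "\<lambda>n. 1"]) auto
qed

theorem theorem1p2:
  fixes f g :: "real fps" and r1 r2 r :: nat
  assumes "f $ 0 = 0" and "fps_deriv f $ 0 * g $ 0 \<noteq> 0"
    and "r1 > 0" and "r2 > 0"
    and "PF r1 g"
    and "PF r2 f \<or> PF r2 (inverse (fps_deriv (fps_inv f)))"
    and "r = min r1 r2"
  shows "(TP r (sheffer_triangle f g) \<and> TP r (sheffer_triangle f (g oo f)))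
    \<and> (TP r (cycle_index_triangle f g) \<and> TP r (cycle_index_triangle f (g oo f)))
    \<and> TP r (logarithmic_triangle f)
    \<and> TP r (fractional_triangle f)"
proof -
  have f: "f $ 0 = 0" "f $ 1 \<noteq> 0"
    using assms(1,2) by auto
  have g: "PF r g" and "PF r f \<or> PF r (inverse (fps_deriv (fps_inv f)))"
    using assms(5-7) by (auto simp: PF_def intro: TP_mono)
  then have R1: "TP r (riordan 1 f)"
    using TP_riordan_of_PF TP_riordan_of_PF_deriv[OF f(1) fps_deriv_eq_compose_inv[OF f]] f(1)
    by blast
  have Rg: "TP r (riordan g f)"
    using TP_riordan_mult[OF g R1] by simp
  have Rgf: "TP r (riordan (g oo f) f)"
    by (rule TP_riordan_compose[OF f(1) g R1])
  show ?thesis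
    unfolding sheffer_triangle_eq[OF f(1), abs_def] cycle_index_triangle_eq[OF f(1), abs_def]
      logarithmic_triangle_eq[OF f(1), abs_def] fractional_triangle_eq[OF f(1), abs_def]
    by (intro conjI TP_scale R1 Rg Rgf) simp_all
qed

end
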